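(* Let $\rho$ be as in the context (with constants $x_*,\rho_*>0$, $\psi_*\ge 0$), let the observations $y_i=\mu_\circ+\sigma_\circ\varepsilon_i$, $i=1,\dots,n$, with `good' index sets $\zeta_n$, $|\zeta_n|=h$, $h/n\to\lambda\in(1/2,1]$, be as in the context, and let $\hat\sigma$ be a scale estimator. Suppose: (1) $\hat\sigma \overset{p}{\to} \varsigma\sigma_\circ$ for some $\varsigma>0$; (2) $h^{-1}\sum_{i\in\zeta_n}\varepsilon_i^2$ is bounded in probability; (3) $h^{-1}\sum_{i\in\zeta_n}\rho(\varepsilon_i/\alpha)\overset{p}{\to}\tilde\rho_\alpha$ uniformly over $\alpha$ in a neighbourhood of $\varsigma$, where $\tilde\rho_\alpha$ is (deterministic and) continuous in $\alpha$. No assumption is made on the `outlier' errors $\varepsilon_j$, $j\in\zeta_n^c$. Suppose further that either (i) $\psi_*>0$ and $\lambda>1/2$; or (ii) $\psi_*=0$ and $\lambda>1/(2-\tilde\rho_\varsigma/\rho_* )$. Let $R_n(\mu)=\sum_{i=1}^n\rho\{(y_i-\mu)/\hat\sigma\}$, $\mu\in\mathbb{R}$. Then, for large $n$, sets with large probability exist on which all minimizers $\hat\mu$ of $R_n(\mu)$ are uniformly bounded and at least one minimizer is measurable. That is, for every $\epsilon>0$ there exist $B<\infty$ and $n_0$ such that for every $n\ge n_0$ there is an event $\mathcal{S}_n$ with $\mathsf{P}(\mathcal{S}_n)>1-\epsilon$ on which every minimizer $\hat\mu$ of $R_n$ satisfies $|\hat\mu|\le B$, and on which a measurable minimizer ex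ists.
   Context: Asymptotic setting. Models are indexed by $n$. For each $n$ there are scalar observations $y_i=\mu_\circ+\sigma_\circ\varepsilon_i$, $i=1,\dots,n$, with fixed $\mu_\circ\in\mathbb{R}$, $\sigma_\circ>0$ and random errors $\varepsilon_i$. There are $h\le n$ `good' observations and $n-h$ `outliers', with $h\to\infty$ as $n\to\infty$ and $h/n\to\lambda$, $1/2<\lambda\le 1$. The set $\zeta_n\subset\{1,\dots,n\}$, $|\zeta_n|=h$, of indices of `good' observations is a deterministic sequence; $\zeta_n^c$ is its complement in $\{1,\dots,n\}$ (indices of `outliers'). Condition on $\rho$. The function $\rho:\mathbb{R}\to\mathbb{R}$ satisfies $\rho(0)=0$, $\rho(x)>0$ for $x\neq 0$, is continuous, symmetric, and non-decreasing in $x>0$, and there are $x_*,\rho_*>0$ and $\psi_*\ge 0$ such that $\rho(x)=\rho_*+\psi_*(|x|-x_* )$ for $|x|\ge x_*$. The scale estimator $\hat\sigma$ is a (measurable) function of the sample. `Bounded in probability' means tight, i.e. $O_p(1)$. *)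

theory Defs
  imports "HOL-Probability.Probability"
begin

definition rho_condition :: "(real \<Rightarrow> real) \<Rightarrow> real \<Rightarrow> real \<Rightarrow> real \<Rightarrow> bool" where
  "rho_condition \<rho> x\<^sub>s \<rho>\<^sub>s \<psi>\<^sub>s \<longleftrightarrow>
     \<rho> 0 = 0 \<and> (\<forall>x. x \<noteq> 0 \<longrightarrow> \<rho> x > 0) \<and>
     continuous_on UNIV \<rho> \<and> (\<forall>x. \<rho> (- x) = \<rho> x) \<and> mono_on {0<..} \<rho> \<and>
     x\<^sub>s > 0 \<and> \<rho>\<^sub>s > 0 \<and> \<psi>\<^sub>s \<ge> 0 \<and>
     (\<forall>x. \<bar>x\<bar> \<ge> x\<^sub>s \<longrightarrow> \<rho> x = \<rho>\<^sub>s + \<psi>\<^sub>s * (\<bar>x\<bar> - x\<^sub>s))"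

text \<open>The probability space may change with \<open>n\<close>.\<close>

definition conv_in_prob :: "(nat \<Rightarrow> 'a measure) \<Rightarrow> (nat \<Rightarrow> 'a \<Rightarrow> real) \<Rightarrow> real \<Rightarrow> bool" where
  "conv_in_prob M X c \<longleftrightarrow>
     (\<forall>e>0. (\<lambda>n. measure (M n) {\<omega> \<in> space (M n). \<bar>X n \<omega> - c\<bar> > e}) \<longlonglongrightarrow> 0)"

text \<open>
  The event below says that the supremum over \<open>U\<close> of the absolute deviation exceeds \<open>e\<close>; this
  form also makes sense when that supremum is infinite. The event is measurable whenever \<open>U\<close> is
  open and, for each \<open>\<omega>\<close>, both \<open>\<alpha> \<mapsto> X n \<alpha> \<omega>\<close> and \<open>c\<close> are continuous on \<open>U\<close>, since \<open>\<alpha>\<close> can then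
  be restricted to the rational points of \<open>U\<close>.
\<close>

definition unif_conv_in_prob ::
    "(nat \<Rightarrow> 'a measure) \<Rightarrow> real set \<Rightarrow> (nat \<Rightarrow> real \<Rightarrow> 'a \<Rightarrow> real) \<Rightarrow> (real \<Rightarrow> real) \<Rightarrow> bool" where
  "unif_conv_in_prob M U X c \<longleftrightarrow>
     (\<forall>e>0. (\<lambda>n. measure (M n) {\<omega> \<in> space (M n). \<exists>\<alpha>\<in>U. \<bar>X n \<alpha> \<omega> - c \<alpha>\<bar> > e}) \<longlonglongrightarrow> 0)"

text \<open>
  Tightness is the library notion \<^const>\<open>tight\<close> for the laws. It quantifies over all \<open>n\<close>; since
  each single law on the reals is tight, this is the same as quantifying over all large \<open>n\<close>.
\<close>

definition bounded_in_prob :: "(nat \<Rightarrow> 'a measure) \<Rightarrow> (nat \<Rightarrow> 'a \<Rightarrow> real) \<Rightarrow> bool" where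
  "bounded_in_prob M X \<longleftrightarrow> tight (\<lambda>n. distr (M n) borel (X n))"

text \<open>
  For \<open>s = 0\<close> the convention \<open>x / 0 = 0\<close> makes the criterion constant. A scale estimate may vanish
  (or be negative), but if it converges in probability to a positive limit, this happens with
  probability tending to zero.
\<close>

definition criterion :: "(real \<Rightarrow> real) \<Rightarrow> nat \<Rightarrow> (nat \<Rightarrow> real) \<Rightarrow> real \<Rightarrow> real \<Rightarrow> real" where
  "criterion \<rho> n y s \<mu> = (\<Sum>i=1..n. \<rho> ((y i - \<mu>) / s))"

end

theory Submission
  imports Defs
begin

text \<open>
  Compare the criterion at a distant \<open>m\<close> with its value at the true centre. If the tails of \<open>\<rho>\<close>
  grow linearly, moving from the centre to \<open>m\<close> raises each good summand by about
  \<open>\<psi>\<^sub>s \<bar>m - \<mu>\<^sub>0\<bar> / \<sigma>hat\<close> and lowers each outlier summand by at most that much, so a good majority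
  suffices. If the tails are constant, nearly all good summands reach the maximum \<open>\<rho>\<^sub>s\<close> at \<open>m\<close>, by
  Chebyshev's inequality, which gives about \<open>h \<rho>\<^sub>s\<close>; at the centre the criterion is at most about
  \<open>h \<rho>tilde vsig + (n - h) \<rho>\<^sub>s\<close>, and the condition on \<open>lam\<close> says that the former is larger. In both
  cases the minimizers stay in a fixed compact interval, on which the smallest minimizer is a
  measurable selection.
\<close>

section \<open>Pointwise bounds on \<rho>\<close>

lemma rho_condition_nonneg:
  assumes "rho_condition \<rho> x\<^sub>s \<rho>\<^sub>s \<psi>\<^sub>s"
  shows "\<rho> x \<ge> 0"
  using assms unfolding rho_condition_def by (metis less_eq_real_def)

lemma rho_condition_le_center:
  assumes "rho_condition \<rho> x\<^sub>s \<rho>\<^sub>s \<psi>\<^sub>s" and "\<bar>x\<bar> \<le> x\<^sub>s"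
  shows "\<rho> x \<le> \<rho>\<^sub>s"
proof (cases "x = 0")
  case True
  then show ?thesis using assms unfolding rho_condition_def by simp
next
  case False
  have "\<rho> x = \<rho> \<bar>x\<bar>"
    using assms unfolding rho_condition_def by (simp add: abs_if)
  also have "\<dots> \<le> \<rho> x\<^sub>s"
    using assms False by (intro mono_onD[of "{0<..}" \<rho>]) (auto simp: rho_condition_def)
  also have "\<dots> = \<rho>\<^sub>s"
    using assms unfolding rho_condition_def by simp
  finally show ?thesis .
qed

text \<open>Together with \<open>rho_condition_lower\<close> this keeps \<rho> within additive
  constants of \<open>\<psi>\<^sub>s * \<bar>x\<bar>\<close> on the whole line, so differences of
  \<rho> can be estimated without asking which arguments lie in the tails. For
  \<open>\<psi>\<^sub>s = 0\<close> it is the global bound \<open>\<rho>\<^sub>s\<close>.\<close>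

lemma rho_condition_upper:
  assumes "rho_condition \<rho> x\<^sub>s \<rho>\<^sub>s \<psi>\<^sub>s"
  shows "\<rho> x \<le> \<rho>\<^sub>s + \<psi>\<^sub>s * \<bar>x\<bar>"
proof (cases "\<bar>x\<bar> \<le> x\<^sub>s")
  case True
  have "0 \<le> \<psi>\<^sub>s * \<bar>x\<bar>"
    using assms unfolding rho_condition_def by simp
  with rho_condition_le_center[OF assms True] show ?thesis by linarith
next
  case False
  then have "\<rho> x = \<rho>\<^sub>s + \<psi>\<^sub>s * (\<bar>x\<bar> - x\<^sub>s)" and "0 \<le> \<psi>\<^sub>s * x\<^sub>s"
    using assms unfolding rho_condition_def by auto
  then show ?thesis by (simp add: algebra_simps)
qed

lemma rho_condition_lower:
  assumes "rho_condition \<rho> x\<^sub>s \<rho>\<^sub>s \<psi>\<^sub>s"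
  shows "\<psi>\<^sub>s * \<bar>x\<bar> - \<psi>\<^sub>s * x\<^sub>s \<le> \<rho> x"
proof (cases "\<bar>x\<bar> \<le> x\<^sub>s")
  case True
  then have "\<psi>\<^sub>s * \<bar>x\<bar> \<le> \<psi>\<^sub>s * x\<^sub>s"
    using assms unfolding rho_condition_def by (simp add: mult_left_mono)
  with rho_condition_nonneg[OF assms, of x] show ?thesis by linarith
next
  case False
  then have "\<rho> x = \<rho>\<^sub>s + \<psi>\<^sub>s * (\<bar>x\<bar> - x\<^sub>s)" and "0 < \<rho>\<^sub>s"
    using assms unfolding rho_condition_def by auto
  then show ?thesis by (simp add: algebra_simps)
qed

section \<open>Deterministic comparison of the criterion at the centre and far away\<close>

text \<open>By the triangle inequality, in passing from \<open>c\<close> to \<open>m\<close> a good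
  summand rises by at least \<open>p * (t - 2 * \<bar>y i - c\<bar>)\<close> and any other summand
  falls by at most \<open>p * t\<close>, both up to the constant \<open>D\<close>. The coefficient
  of \<open>p * t\<close> in the total is the surplus of good over bad indices, at least
  \<open>\<eta> * n\<close>, so a large \<open>t\<close> absorbs both the deviations collected in
  \<open>A\<close> and the constants, wherever the outliers are.\<close>

lemma criterion_less_far_linear_tails:
  assumes rho: "rho_condition \<rho> x\<^sub>s \<rho>\<^sub>s \<psi>\<^sub>s" and psi: "\<psi>\<^sub>s > 0" and s: "s > 0"
    and n: "n > 0" and G: "G \<subseteq> {1..n}"
    and majority: "real n + \<eta> * real n \<le> 2 * real (card G)"
    and dev: "(\<Sum>i\<in>G. \<bar>y i - c\<bar>) \<le> A * real n"
    and far: "2 * A + (\<psi>\<^sub>s * x\<^sub>s + \<rho>\<^sub>s) * s / \<psi>\<^sub>s < \<eta> * \<bar>m - c\<bar>"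
  shows "criterion \<rho> n y s c < criterion \<rho> n y s m"
proof -
  define D where "D = \<psi>\<^sub>s * x\<^sub>s + \<rho>\<^sub>s"
  define p where "p = \<psi>\<^sub>s / s"
  define O' where "O' = {1..n} - G"
  define t where "t = \<bar>m - c\<bar>"
  have p: "p > 0" using psi s by (simp add: p_def)
  have fin: "finite G" using G finite_subset by blast
  \<comment> \<open>The constants of the lower bound at \<open>m\<close> and of the upper bound at
    \<open>c\<close> add up to \<open>D\<close>.\<close>
  have diff: "\<rho> ((y i - m) / s) - \<rho> ((y i - c) / s) \<ge> p * (\<bar>y i - m\<bar> - \<bar>y i - c\<bar>) - D" for i
    using rho_condition_lower[OF rho, of "(y i - m) / s"]
      rho_condition_upper[OF rho, of "(y i - c) / s"] s
    by (simp add: p_def D_def abs_divide right_diff_distrib)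
  have good: "p * (t - 2 * \<bar>y i - c\<bar>) - D \<le> \<rho> ((y i - m) / s) - \<rho> ((y i - c) / s)" for i
  proof -
    have "t - 2 * \<bar>y i - c\<bar> \<le> \<bar>y i - m\<bar> - \<bar>y i - c\<bar>" by (simp add: t_def)
    then have "p * (t - 2 * \<bar>y i - c\<bar>) \<le> p * (\<bar>y i - m\<bar> - \<bar>y i - c\<bar>)"
      using p by (intro mult_left_mono) auto
    with diff[of i] show ?thesis by linarith
  qed
  have bad: "p * (- t) - D \<le> \<rho> ((y i - m) / s) - \<rho> ((y i - c) / s)" for i
  proof -
    have "- t \<le> \<bar>y i - m\<bar> - \<bar>y i - c\<bar>" by (simp add: t_def)
    then have "p * (- t) \<le> p * (\<bar>y i - m\<bar> - \<bar>y i - c\<bar>)"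
      using p by (intro mult_left_mono) auto
    with diff[of i] show ?thesis by linarith
  qed
  have card_O: "real (card O') = real n - real (card G)"
    using card_Diff_subset[OF fin G] card_mono[OF _ G] by (simp add: O'_def of_nat_diff)
  have "criterion \<rho> n y s m - criterion \<rho> n y s c
        = (\<Sum>i\<in>{1..n}. \<rho> ((y i - m) / s) - \<rho> ((y i - c) / s))"
    by (simp add: criterion_def sum_subtractf)
  also have "\<dots> = (\<Sum>i\<in>G. \<rho> ((y i - m) / s) - \<rho> ((y i - c) / s))
                + (\<Sum>i\<in>O'. \<rho> ((y i - m) / s) - \<rho> ((y i - c) / s))"
    using G by (simp add: O'_def sum.subset_diff)
  also have "\<dots> \<ge> (\<Sum>i\<in>G. p * (t - 2 * \<bar>y i - c\<bar>) - D) + (\<Sum>i\<in>O'. p * (- t) - D)"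
    by (intro add_mono sum_mono good bad)
  also have "(\<Sum>i\<in>G. p * (t - 2 * \<bar>y i - c\<bar>) - D) + (\<Sum>i\<in>O'. p * (- t) - D)
        = p * ((2 * real (card G) - real n) * t - 2 * (\<Sum>i\<in>G. \<bar>y i - c\<bar>)) - real n * D"
    by (simp add: sum_subtractf card_O flip: sum_distrib_left) (simp add: algebra_simps)
  finally have le: "p * ((2 * real (card G) - real n) * t - 2 * (\<Sum>i\<in>G. \<bar>y i - c\<bar>)) - real n * D
        \<le> criterion \<rho> n y s m - criterion \<rho> n y s c" .
  have "\<eta> * real n * t \<le> (2 * real (card G) - real n) * t"
    using majority by (intro mult_right_mono) (auto simp: t_def)
  then have "real n * (\<eta> * t - 2 * A) \<le> (2 * real (card G) - real n) * t - 2 * (\<Sum>i\<in>G. \<bar>y i - c\<bar>)"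
    using dev by (simp add: algebra_simps)
  then have "p * (real n * (\<eta> * t - 2 * A))
      \<le> p * ((2 * real (card G) - real n) * t - 2 * (\<Sum>i\<in>G. \<bar>y i - c\<bar>))"
    using p by (intro mult_left_mono) auto
  moreover have "real n * D < p * (real n * (\<eta> * t - 2 * A))"
  proof -
    \<comment> \<open>Since \<open>D / p = D * s / \<psi>\<^sub>s\<close>, this is
      \<open>far\<close> rearranged.\<close>
    have "D / p < \<eta> * t - 2 * A"
      using far by (simp add: D_def p_def t_def)
    then have "D < p * (\<eta> * t - 2 * A)"
      using p by (simp add: pos_divide_less_eq mult.commute)
    then show ?thesis using n by simp
  qed
  ultimately show ?thesis using le by linarith
qed

text \<open>At \<open>c\<close>, every index outside \<open>G\<close> costs at most
  \<open>\<rho>\<^sub>s\<close>. At \<open>m\<close>, every good observation within \<open>L\<close>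
  of \<open>c\<close> has a standardized residual of size at least \<open>x\<^sub>s\<close>, hence
  costs exactly \<open>\<rho>\<^sub>s\<close>, and the other summands are nonnegative. The
  assumption \<open>few\<close> compares these two bounds.\<close>

lemma criterion_less_far_constant_tails:
  assumes rho: "rho_condition \<rho> x\<^sub>s \<rho>\<^sub>s 0" and s: "s > 0" and G: "G \<subseteq> {1..n}"
    and centre: "(\<Sum>i\<in>G. \<rho> ((y i - c) / s)) \<le> q"
    and few: "q + \<rho>\<^sub>s * (real n - real (card G)) < \<rho>\<^sub>s * real (card {i\<in>G. \<bar>y i - c\<bar> \<le> L})"
    and far: "L + x\<^sub>s * s \<le> \<bar>m - c\<bar>"
  shows "criterion \<rho> n y s c < criterion \<rho> n y s m"
proof -
  have fin: "finite G" using G finite_subset by blast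
  have card_O: "real (card ({1..n} - G)) = real n - real (card G)"
    using card_Diff_subset[OF fin G] card_mono[OF _ G] by (simp add: of_nat_diff)
  have "criterion \<rho> n y s c
      = (\<Sum>i\<in>{1..n} - G. \<rho> ((y i - c) / s)) + (\<Sum>i\<in>G. \<rho> ((y i - c) / s))"
    unfolding criterion_def using G by (intro sum.subset_diff) auto
  also have "\<dots> \<le> (\<Sum>i\<in>{1..n} - G. \<rho>\<^sub>s) + q"
    using rho_condition_upper[OF rho] by (intro add_mono sum_mono centre) simp
  also have "\<dots> < \<rho>\<^sub>s * real (card {i\<in>G. \<bar>y i - c\<bar> \<le> L})"
    using few by (simp add: card_O mult.commute del: One_nat_def)
  also have "\<dots> = (\<Sum>i\<in>{i\<in>G. \<bar>y i - c\<bar> \<le> L}. \<rho> ((y i - m) / s))"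
  proof -
    have "\<rho> ((y i - m) / s) = \<rho>\<^sub>s" if "\<bar>y i - c\<bar> \<le> L" for i
    proof -
      have "x\<^sub>s * s \<le> \<bar>y i - m\<bar>" using that far by linarith
      then have "x\<^sub>s \<le> \<bar>(y i - m) / s\<bar>" using s by (simp add: abs_divide pos_le_divide_eq)
      then show ?thesis using rho unfolding rho_condition_def by simp
    qed
    then show ?thesis by (simp add: mult.commute)
  qed
  also have "\<dots> \<le> criterion \<rho> n y s m"
    unfolding criterion_def using G
    by (intro sum_mono2) (auto intro: rho_condition_nonneg[OF rho])
  finally show ?thesis .
qed

text \<open>Chebyshev's inequality for the counting measure on \<open>G\<close>.\<close>

lemma card_large_le_second_moment:
  fixes x :: "'i \<Rightarrow> real"
  assumes "finite G" and "K > 0"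
  shows "real (card {i\<in>G. K < \<bar>x i\<bar>}) \<le> (\<Sum>i\<in>G. (x i)\<^sup>2) / K\<^sup>2"
proof -
  have "real (card {i\<in>G. K < \<bar>x i\<bar>}) * K\<^sup>2 = (\<Sum>i\<in>{i\<in>G. K < \<bar>x i\<bar>}. K\<^sup>2)"
    by simp
  also have "\<dots> \<le> (\<Sum>i\<in>{i\<in>G. K < \<bar>x i\<bar>}. (x i)\<^sup>2)"
    using assms by (intro sum_mono) (auto intro: power2_le_iff_abs_le[THEN iffD2] simp: abs_le_square_iff[symmetric])
  also have "\<dots> \<le> (\<Sum>i\<in>G. (x i)\<^sup>2)"
    using assms by (intro sum_mono2) auto
  finally show ?thesis using assms by (simp add: pos_le_divide_eq)
qed

section \<open>Measurability of events over a continuum and of the smallest minimizer\<close>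

lemma continuous_on_gt_dense:
  fixes f :: "'b::metric_space \<Rightarrow> real"
  assumes "continuous_on S f" "D \<subseteq> S" "S \<subseteq> closure D" "x \<in> S" "f x > e"
  shows "\<exists>d\<in>D. f d > e"
proof -
  obtain r where r: "r > 0" "\<And>z. z \<in> S \<Longrightarrow> dist z x < r \<Longrightarrow> dist (f z) (f x) < f x - e"
    using assms(1,4,5) unfolding continuous_on_iff by (metis diff_gt_0_iff_gt)
  obtain d where "d \<in> D" "dist d x < r"
    using assms(3,4) r(1) closure_approachable by blast
  with r(2)[of d] assms(2) show ?thesis by (intro bexI[of _ d]) (auto simp: dist_real_def)
qed

text \<open>A strict inequality for a continuous function persists nearby, so the witness can be
  sought in a countable dense subset of \<open>S\<close>, and the event becomes a countable union.
  It serves both the uniform deviation over \<open>U\<close> and the minimizer below.\<close>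

lemma sets_ex_gt_continuous:
  fixes f :: "'a \<Rightarrow> real \<Rightarrow> real"
  assumes meas: "\<And>x. x \<in> S \<Longrightarrow> (\<lambda>\<omega>. f \<omega> x) \<in> borel_measurable M"
    and cont: "\<And>\<omega>. \<omega> \<in> space M \<Longrightarrow> continuous_on S (f \<omega>)"
  shows "{\<omega> \<in> space M. \<exists>x\<in>S. f \<omega> x > e} \<in> sets M"
proof -
  obtain D where D: "countable D" "D \<subseteq> S" "S \<subseteq> closure D"
    using separable by blast
  have "{\<omega> \<in> space M. \<exists>x\<in>S. f \<omega> x > e} = {\<omega> \<in> space M. \<exists>x\<in>D. f \<omega> x > e}"
    using continuous_on_gt_dense[OF cont D(2,3)] D(2) by blast
  also have "\<dots> = (\<Union>x\<in>D. {\<omega> \<in> space M. f \<omega> x > e})" by blast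
  also have "\<dots> \<in> sets M"
    using D meas by (intro sets.countable_UN'') (auto intro!: borel_measurable_less)
  finally show ?thesis .
qed

text \<open>The minimizers over a compact interval form a nonempty closed set, so their infimum is
  itself a minimizer. Choosing the smallest one fixes a canonical selection whose sublevel events
  can be written with countably many comparisons.\<close>

lemma measurable_argmin_interval:
  fixes f :: "'a \<Rightarrow> real \<Rightarrow> real"
  assumes cd: "c \<le> d"
    and meas: "\<And>x. (\<lambda>\<omega>. f \<omega> x) \<in> borel_measurable M"
    and cont: "\<And>\<omega>. \<omega> \<in> space M \<Longrightarrow> continuous_on UNIV (f \<omega>)"
  shows "\<exists>g\<in>borel_measurable M. \<forall>\<omega>\<in>space M. g \<omega> \<in> {c..d} \<and> (\<forall>x\<in>{c..d}. f \<omega> (g \<omega>) \<le> f \<omega> x)"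
proof -
  define A where "A \<omega> = {m\<in>{c..d}. \<forall>x\<in>{c..d}. f \<omega> m \<le> f \<omega> x}" for \<omega>
  define g where "g \<omega> = Inf (A \<omega>)" for \<omega>
  have g_in: "g \<omega> \<in> A \<omega>" and g_le: "\<And>m. m \<in> A \<omega> \<Longrightarrow> g \<omega> \<le> m" if "\<omega> \<in> space M" for \<omega>
  proof -
    have cont': "continuous_on {c..d} (f \<omega>)"
      using cont[OF that] continuous_on_subset by blast
    have "A \<omega> \<noteq> {}"
      using continuous_attains_inf[OF _ _ cont'] cd by (auto simp: A_def)
    moreover have bdd: "bdd_below (A \<omega>)" by (auto simp: A_def bdd_below_def)
    moreover have "closed (A \<omega>)"
    proof -
      have "A \<omega> = {c..d} \<inter> (\<Inter>x\<in>{c..d}. {m. f \<omega> m \<le> f \<omega> x})" by (auto simp: A_def)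
      moreover have "closed {m. f \<omega> m \<le> f \<omega> x}" for x
        using cont[OF that] by (intro closed_Collect_le) auto
      ultimately show ?thesis by (auto intro!: closed_Int closed_INT simp del: Int_iff)
    qed
    ultimately show "g \<omega> \<in> A \<omega>" by (simp add: g_def closed_contains_Inf)
    show "\<And>m. m \<in> A \<omega> \<Longrightarrow> g \<omega> \<le> m"
      using bdd by (simp add: g_def cInf_lower)
  qed
  have "g \<in> borel_measurable M"
  proof (rule borel_measurableI_le)
    fix a
    show "{\<omega> \<in> space M. g \<omega> \<le> a} \<in> sets M"
    proof (cases "c \<le> a")
      case False
      then have "{\<omega> \<in> space M. g \<omega> \<le> a} = {}" using g_in by (force simp: A_def)
      then show ?thesis by (simp only: sets.empty_sets)
    next
      case True
      \<comment> \<open>The cap at \<open>d\<close> keeps \<open>{c..b}\<close> inside the interval: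
        it consists of the candidates that are at most \<open>a\<close>.\<close>
      define b where "b = min a d"
      have b: "c \<le> b" "b \<le> d" using True cd by (auto simp: b_def)
      obtain D where D: "countable D" "D \<subseteq> {c..d}" "{c..d} \<subseteq> closure D"
        using separable by blast
      \<comment> \<open>The smallest minimizer exceeds \<open>a\<close> iff a point of \<open>D\<close> beats all of \<open>{c..b}\<close>; by compactness
        it does so with a positive margin, which reduces the event to countably many points.\<close>
      have approx: "\<not> (g \<omega> \<le> a) \<longleftrightarrow> (\<exists>k. \<exists>q\<in>D. \<forall>m\<in>{c..b}. f \<omega> q + inverse (real (Suc k)) \<le> f \<omega> m)"
        if w: "\<omega> \<in> space M" for \<omega>
      proof
        assume "\<not> (g \<omega> \<le> a)"
        have "continuous_on {c..b} (f \<omega>)" using cont[OF w] continuous_on_subset by blast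
        from continuous_attains_inf[OF _ _ this] b
        obtain m0 where m0: "m0 \<in> {c..b}" "\<forall>m\<in>{c..b}. f \<omega> m0 \<le> f \<omega> m" by auto
        \<comment> \<open>If \<open>m0\<close> minimized over all of \<open>{c..d}\<close>, the
          smallest minimizer would be at most \<open>m0\<close>, hence at most
          \<open>a\<close>.\<close>
        have "m0 \<notin> A \<omega>"
          using g_le[OF w, of m0] m0(1) \<open>\<not> (g \<omega> \<le> a)\<close> by (auto simp: b_def)
        then obtain x where x: "x \<in> {c..d}" "f \<omega> x < f \<omega> m0"
          using m0(1) b by (auto simp: A_def not_le)
        have "continuous_on {c..d} (\<lambda>x. - f \<omega> x)"
          using cont[OF w] continuous_on_subset by (intro continuous_on_minus) blast
        from continuous_on_gt_dense[OF this D(2,3) x(1), of "- f \<omega> m0"] x(2)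
        obtain q where q: "q \<in> D" "f \<omega> q < f \<omega> m0" by auto
        then obtain k where "inverse (real (Suc k)) < f \<omega> m0 - f \<omega> q"
          using reals_Archimedean[of "f \<omega> m0 - f \<omega> q"] by auto
        with q m0(2) show "\<exists>k. \<exists>q\<in>D. \<forall>m\<in>{c..b}. f \<omega> q + inverse (real (Suc k)) \<le> f \<omega> m"
          by (intro exI[of _ k] bexI[of _ q]) force+
      next
        assume "\<exists>k. \<exists>q\<in>D. \<forall>m\<in>{c..b}. f \<omega> q + inverse (real (Suc k)) \<le> f \<omega> m"
        then obtain k q where kq: "q \<in> D" "\<And>m. m \<in> {c..b} \<Longrightarrow> f \<omega> q + inverse (real (Suc k)) \<le> f \<omega> m"
          by blast
        show "\<not> (g \<omega> \<le> a)"
        proof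
          assume "g \<omega> \<le> a"
          then have "g \<omega> \<in> {c..b}" using g_in[OF w] by (auto simp: A_def b_def)
          with kq(2) have "f \<omega> q < f \<omega> (g \<omega>)"
            by (smt (verit) inverse_positive_iff_positive of_nat_0_less_iff zero_less_Suc)
          with g_in[OF w] kq(1) D(2) show False by (force simp: A_def)
        qed
      qed
      \<comment> \<open>Negating the comparison with margin gives a strict inequality at some point
        of \<open>{c..b}\<close>, which is the form that \<open>sets_ex_gt_continuous\<close>
        handles.\<close>
      have le_iff: "g \<omega> \<le> a \<longleftrightarrow>
          (\<forall>k. \<forall>q\<in>D. \<exists>m\<in>{c..b}. f \<omega> q + inverse (real (Suc k)) - f \<omega> m > 0)"
        if "\<omega> \<in> space M" for \<omega>
        using approx[OF that] by (meson diff_gt_0_iff_gt not_le)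
      have ev: "{\<omega> \<in> space M. \<exists>m\<in>{c..b}. f \<omega> q + inverse (real (Suc k)) - f \<omega> m > 0} \<in> sets M" for k q
      proof (rule sets_ex_gt_continuous)
        fix \<omega> assume "\<omega> \<in> space M"
        then have "continuous_on {c..b} (f \<omega>)" using cont continuous_on_subset by blast
        then show "continuous_on {c..b} (\<lambda>m. f \<omega> q + inverse (real (Suc k)) - f \<omega> m)"
          by (intro continuous_intros)
      qed (use meas in measurable)
      have "{\<omega> \<in> space M. g \<omega> \<le> a} = space M - (\<Union>k. \<Union>q\<in>D. space M -
          {\<omega> \<in> space M. \<exists>m\<in>{c..b}. f \<omega> q + inverse (real (Suc k)) - f \<omega> m > 0})"
        using le_iff by blast
      also have "\<dots> \<in> sets M"
        using D(1) ev by (intro sets.Diff sets.top sets.countable_UN'' countableI_type) auto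
      finally show ?thesis .
    qed
  qed
  moreover have "\<forall>\<omega>\<in>space M. g \<omega> \<in> {c..d} \<and> (\<forall>x\<in>{c..d}. f \<omega> (g \<omega>) \<le> f \<omega> x)"
    using g_in by (auto simp: A_def)
  ultimately show ?thesis by blast
qed

text \<open>On \<open>S\<close> the point \<open>c\<close> beats everything farther away than
  \<open>K\<close>, so global minimization reduces to the interval of radius \<open>K\<close> around
  \<open>c\<close>. The selection from that interval is measurable on the whole space and is a
  global minimizer on \<open>S\<close>.\<close>

lemma argmin_bounded_and_measurable:
  fixes f :: "'a \<Rightarrow> real \<Rightarrow> real"
  assumes meas: "\<And>x. (\<lambda>\<omega>. f \<omega> x) \<in> borel_measurable M"
    and cont: "\<And>\<omega>. \<omega> \<in> space M \<Longrightarrow> continuous_on UNIV (f \<omega>)"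
    and S: "S \<in> sets M" and K: "K \<ge> 0"
    and far: "\<And>\<omega> m. \<omega> \<in> S \<Longrightarrow> K < \<bar>m - c\<bar> \<Longrightarrow> f \<omega> c < f \<omega> m"
  shows "(\<forall>\<omega>\<in>S. \<forall>m. is_arg_min (f \<omega>) (\<lambda>_. True) m \<longrightarrow> \<bar>m\<bar> \<le> \<bar>c\<bar> + K) \<and>
     (\<exists>g\<in>borel_measurable M. \<forall>\<omega>\<in>S. is_arg_min (f \<omega>) (\<lambda>_. True) (g \<omega>))"
proof
  show "\<forall>\<omega>\<in>S. \<forall>m. is_arg_min (f \<omega>) (\<lambda>_. True) m \<longrightarrow> \<bar>m\<bar> \<le> \<bar>c\<bar> + K"
  proof (intro ballI allI impI)
    fix \<omega> m assume "\<omega> \<in> S" "is_arg_min (f \<omega>) (\<lambda>_. True) m"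
    then have "\<not> K < \<bar>m - c\<bar>" using far unfolding is_arg_min_def by blast
    then show "\<bar>m\<bar> \<le> \<bar>c\<bar> + K" by linarith
  qed
  obtain g where g: "g \<in> borel_measurable M"
    "\<And>\<omega>. \<omega> \<in> space M \<Longrightarrow> \<forall>x\<in>{c - K..c + K}. f \<omega> (g \<omega>) \<le> f \<omega> x"
    using measurable_argmin_interval[OF _ meas cont, of "c - K" "c + K"] K by auto
  have "is_arg_min (f \<omega>) (\<lambda>_. True) (g \<omega>)" if "\<omega> \<in> S" for \<omega>
  proof -
    have w: "\<omega> \<in> space M" using that S sets.sets_into_space by blast
    have "f \<omega> (g \<omega>) \<le> f \<omega> x" for x
    proof (cases "K < \<bar>x - c\<bar>")
      case True
      have "f \<omega> (g \<omega>) \<le> f \<omega> c" using g(2)[OF w] K by auto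
      with far[OF that True] show ?thesis by linarith
    next
      case False
      then have "x \<in> {c - K..c + K}" by (auto simp: abs_if split: if_splits)
      then show ?thesis using g(2)[OF w] by blast
    qed
    then show ?thesis by (auto simp: is_arg_min_def not_less)
  qed
  with g(1) show "\<exists>g\<in>borel_measurable M. \<forall>\<omega>\<in>S. is_arg_min (f \<omega>) (\<lambda>_. True) (g \<omega>)" by blast
qed

theorem theorem3p1:
  fixes M :: "nat \<Rightarrow> 'a measure"
    and \<epsilon> y :: "nat \<Rightarrow> nat \<Rightarrow> 'a \<Rightarrow> real"
    and T :: "nat \<Rightarrow> (nat \<Rightarrow> real) \<Rightarrow> real"
    and \<sigma>hat :: "nat \<Rightarrow> 'a \<Rightarrow> real"
    and h :: "nat \<Rightarrow> nat" and \<zeta> :: "nat \<Rightarrow> nat set"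
    and \<rho> \<rho>tilde :: "real \<Rightarrow> real" and U :: "real set"
    and \<mu>\<^sub>0 \<sigma>\<^sub>0 lam vsig x\<^sub>s \<rho>\<^sub>s \<psi>\<^sub>s :: real
  assumes rho: "rho_condition \<rho> x\<^sub>s \<rho>\<^sub>s \<psi>\<^sub>s"
    and prob: "\<And>n. prob_space (M n)"
    and errors: "\<And>n i. i \<in> {1..n} \<Longrightarrow> \<epsilon> n i \<in> borel_measurable (M n)"
    and sigma0: "\<sigma>\<^sub>0 > 0"
    and obs: "\<And>n i \<omega>. y n i \<omega> = \<mu>\<^sub>0 + \<sigma>\<^sub>0 * \<epsilon> n i \<omega>"
    and h_le: "\<And>n. h n \<le> n"
    and h_inf: "filterlim h at_top sequentially"
    and h_ratio: "(\<lambda>n. real (h n) / real n) \<longlonglongrightarrow> lam"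
    and lam_range: "1 / 2 < lam" "lam \<le> 1"
    and zeta: "\<And>n. \<zeta> n \<subseteq> {1..n}" "\<And>n. card (\<zeta> n) = h n"
    and T_meas: "\<And>n. T n \<in> borel_measurable (Pi\<^sub>M {1..n} (\<lambda>_. borel))"
    and sigma_hat: "\<And>n \<omega>. \<sigma>hat n \<omega> = T n (\<lambda>i\<in>{1..n}. y n i \<omega>)"
    and varsigma: "vsig > 0"
    and A1: "conv_in_prob M \<sigma>hat (vsig * \<sigma>\<^sub>0)"
    and A2: "bounded_in_prob M (\<lambda>n \<omega>. (\<Sum>i\<in>\<zeta> n. (\<epsilon> n i \<omega>)\<^sup>2) / real (h n))"
    and U: "open U" "vsig \<in> U" "U \<subseteq> {0<..}"
    and A3: "unif_conv_in_prob M U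
               (\<lambda>n \<alpha> \<omega>. (\<Sum>i\<in>\<zeta> n. \<rho> (\<epsilon> n i \<omega> / \<alpha>)) / real (h n)) \<rho>tilde"
    and A3_cont: "continuous_on U \<rho>tilde"
    and cases: "(\<psi>\<^sub>s > 0 \<and> lam > 1 / 2) \<or> (\<psi>\<^sub>s = 0 \<and> lam > 1 / (2 - \<rho>tilde vsig / \<rho>\<^sub>s))"
  shows "\<forall>e>0. \<exists>B n\<^sub>0. \<forall>n\<ge>n\<^sub>0. \<exists>S \<in> sets (M n). measure (M n) S > 1 - e \<and>
           (\<forall>\<omega>\<in>S. \<forall>m. is_arg_min (criterion \<rho> n (\<lambda>i. y n i \<omega>) (\<sigma>hat n \<omega>)) (\<lambda>_. True) m \<longrightarrow> \<bar>m\<bar> \<le> B) \<and>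
           (\<exists>\<mu>hat \<in> borel_measurable (M n). \<forall>\<omega>\<in>S.
              is_arg_min (criterion \<rho> n (\<lambda>i. y n i \<omega>) (\<sigma>hat n \<omega>)) (\<lambda>_. True) (\<mu>hat \<omega>))"

proof -

  \<comment> \<open>Measurability and continuity of the criterion\<close>
  have rho_cont: "continuous_on UNIV \<rho>" using rho by (simp add: rho_condition_def)
  have rho_meas [measurable]: "\<rho> \<in> borel_measurable borel"
    using rho_cont by (rule borel_measurable_continuous_onI)
  have rho_pos: "\<rho>\<^sub>s > 0" "x\<^sub>s > 0" using rho by (auto simp: rho_condition_def)
  have zeta_fin: "finite (\<zeta> n)" for n using zeta(1) finite_subset by blast
  have eps_meas: "\<epsilon> n i \<in> borel_measurable (M n)" if "i \<in> \<zeta> n" for n i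
    using errors zeta(1) that by blast
  have y_meas: "y n i \<in> borel_measurable (M n)" if "i \<in> {1..n}" for n i
    unfolding obs using errors[OF that] by measurable
  have sig_meas [measurable]: "\<sigma>hat n \<in> borel_measurable (M n)" for n
  proof -
    have "(\<lambda>\<omega>. \<lambda>i\<in>{1..n}. y n i \<omega>) \<in> measurable (M n) (Pi\<^sub>M {1..n} (\<lambda>_. borel))"
      using y_meas by (intro measurable_restrict) auto
    from measurable_compose[OF this T_meas] show ?thesis unfolding sigma_hat[abs_def] .
  qed
  have crit_meas: "(\<lambda>\<omega>. criterion \<rho> n (\<lambda>i. y n i \<omega>) (\<sigma>hat n \<omega>) m) \<in> borel_measurable (M n)" for n m
    unfolding criterion_def using y_meas
    by (intro borel_measurable_sum measurable_compose[OF _ rho_meas]) auto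
  \<comment> \<open>Division is multiplication by a constant inverse, with
    \<open>inverse 0 = 0\<close>, so continuity holds also where the scale estimate
    vanishes.\<close>
  have crit_cont: "continuous_on UNIV (criterion \<rho> n (\<lambda>i. y n i \<omega>) (\<sigma>hat n \<omega>))" for n \<omega>
    unfolding criterion_def divide_inverse
    by (intro continuous_on_sum continuous_on_compose2[OF rho_cont] continuous_intros) auto

  \<comment> \<open>The event of large probability\<close>
  define q where "q n \<omega> = (\<Sum>i\<in>\<zeta> n. (\<epsilon> n i \<omega>)\<^sup>2) / real (h n)" for n \<omega>
  define X where "X n \<alpha> \<omega> = (\<Sum>i\<in>\<zeta> n. \<rho> (\<epsilon> n i \<omega> / \<alpha>)) / real (h n)" for n \<alpha> \<omega>
  define good where "good \<delta> C \<tau> n = {\<omega> \<in> space (M n). \<bar>\<sigma>hat n \<omega> - vsig * \<sigma>\<^sub>0\<bar> \<le> \<delta> \<and> q n \<omega> \<le> C \<and>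
      (\<forall>\<alpha>\<in>U. \<bar>X n \<alpha> \<omega> - \<rho>tilde \<alpha>\<bar> \<le> \<tau>)}" for \<delta> C \<tau> n
  have q_meas [measurable]: "q n \<in> borel_measurable (M n)" for n
    unfolding q_def using eps_meas by (intro borel_measurable_divide borel_measurable_sum) auto
  have dev_sets: "{\<omega> \<in> space (M n). \<exists>\<alpha>\<in>U. \<bar>X n \<alpha> \<omega> - \<rho>tilde \<alpha>\<bar> > \<tau>} \<in> sets (M n)" for n \<tau>
  proof (rule sets_ex_gt_continuous)
    show "(\<lambda>\<omega>. \<bar>X n \<alpha> \<omega> - \<rho>tilde \<alpha>\<bar>) \<in> borel_measurable (M n)" for \<alpha>
      unfolding X_def using eps_meas
      by (intro borel_measurable_abs borel_measurable_diff borel_measurable_divide borel_measurable_sum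
          measurable_compose[OF _ rho_meas]) auto
    \<comment> \<open>\<open>U\<close> contains only positive numbers, so dividing by \<alpha> is
      continuous there.\<close>
    show "continuous_on U (\<lambda>\<alpha>. \<bar>X n \<alpha> \<omega> - \<rho>tilde \<alpha>\<bar>)" for \<omega>
      unfolding X_def divide_inverse[of "sum _ _"] using U(3) A3_cont
      by (intro continuous_intros continuous_on_compose2[OF rho_cont]) auto
  qed
  have sig_ev: "{\<omega> \<in> space (M n). \<bar>\<sigma>hat n \<omega> - vsig * \<sigma>\<^sub>0\<bar> > \<delta>} \<in> sets (M n)" for n \<delta>
    by measurable
  have q_ev: "{\<omega> \<in> space (M n). q n \<omega> > C} \<in> sets (M n)" for n C
    by measurable
  have good_eq: "good \<delta> C \<tau> n = space (M n) - ({\<omega> \<in> space (M n). \<bar>\<sigma>hat n \<omega> - vsig * \<sigma>\<^sub>0\<bar> > \<delta>} \<union>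
      {\<omega> \<in> space (M n). q n \<omega> > C} \<union> {\<omega> \<in> space (M n). \<exists>\<alpha>\<in>U. \<bar>X n \<alpha> \<omega> - \<rho>tilde \<alpha>\<bar> > \<tau>})" for \<delta> C \<tau> n
    by (auto simp: good_def not_less)
  have good_sets: "good \<delta> C \<tau> n \<in> sets (M n)" for \<delta> C \<tau> n
    unfolding good_eq using sig_ev q_ev dev_sets by blast
  have q_tight: "\<exists>C>0. \<forall>n. measure (M n) {\<omega> \<in> space (M n). q n \<omega> > C} < d" if d: "d > 0" for d
  proof -
    from A2 d obtain a b where ab: "\<And>n. measure (distr (M n) borel (q n)) {a<..b} > 1 - d"
      unfolding bounded_in_prob_def tight_def q_def by blast
    \<comment> \<open>The upper end \<open>b\<close> of the tightness interval serves all
      \<open>n\<close>; the maximum with 1 makes the bound positive.\<close>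
    have "measure (M n) {\<omega> \<in> space (M n). q n \<omega> > max b 1} < d" for n
    proof -
      interpret prob_space "M n" by (rule prob)
      have "measure (distr (M n) borel (q n)) {a<..b} = prob {\<omega> \<in> space (M n). q n \<omega> \<in> {a<..b}}"
        by (subst measure_distr) (auto intro!: arg_cong[where f = prob])
      also have "\<dots> \<le> prob (space (M n) - {\<omega> \<in> space (M n). q n \<omega> > max b 1})"
        using q_ev by (intro finite_measure_mono) auto
      also have "\<dots> = 1 - prob {\<omega> \<in> space (M n). q n \<omega> > max b 1}"
        using q_ev by (rule prob_compl)
      finally show ?thesis using ab[of n] by linarith
    qed
    then show ?thesis by (intro exI[of _ "max b 1"]) auto
  qed
  \<comment> \<open>The bound \<open>C\<close> depends on \<open>e\<close> alone, so \<delta> and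
    \<tau> can still be chosen after it. Each of the three exceptional events gets probability below
    \<open>e / 3\<close>.\<close>
  have good_large: "\<exists>C>0. \<forall>\<delta>>0. \<forall>\<tau>>0. \<forall>\<^sub>F n in sequentially. measure (M n) (good \<delta> C \<tau> n) > 1 - e"
    if e: "e > 0" for e
  proof -
    obtain C where C: "C > 0" "\<And>n. measure (M n) {\<omega> \<in> space (M n). q n \<omega> > C} < e / 3"
      using q_tight[of "e / 3"] e by auto
    have "\<forall>\<^sub>F n in sequentially. measure (M n) (good \<delta> C \<tau> n) > 1 - e" if "\<delta> > 0" "\<tau> > 0" for \<delta> \<tau>
    proof -
      have "\<forall>\<^sub>F n in sequentially. measure (M n) {\<omega> \<in> space (M n). \<bar>\<sigma>hat n \<omega> - vsig * \<sigma>\<^sub>0\<bar> > \<delta>} < e / 3"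
        using A1 \<open>\<delta> > 0\<close> e unfolding conv_in_prob_def by (intro order_tendstoD(2)[of _ 0]) auto
      moreover have "\<forall>\<^sub>F n in sequentially.
          measure (M n) {\<omega> \<in> space (M n). \<exists>\<alpha>\<in>U. \<bar>X n \<alpha> \<omega> - \<rho>tilde \<alpha>\<bar> > \<tau>} < e / 3"
        using A3 \<open>\<tau> > 0\<close> e unfolding unif_conv_in_prob_def X_def by (intro order_tendstoD(2)[of _ 0]) auto
      ultimately show ?thesis
      proof eventually_elim
        case (elim n)
        interpret prob_space "M n" by (rule prob)
        let ?P = "{\<omega> \<in> space (M n). \<bar>\<sigma>hat n \<omega> - vsig * \<sigma>\<^sub>0\<bar> > \<delta>}"
        let ?Q = "{\<omega> \<in> space (M n). q n \<omega> > C}"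
        let ?R = "{\<omega> \<in> space (M n). \<exists>\<alpha>\<in>U. \<bar>X n \<alpha> \<omega> - \<rho>tilde \<alpha>\<bar> > \<tau>}"
        have "prob (?P \<union> ?Q \<union> ?R) \<le> prob (?P \<union> ?Q) + prob ?R"
          by (intro measure_Un_le sets.Un sig_ev q_ev dev_sets)
        also have "prob (?P \<union> ?Q) \<le> prob ?P + prob ?Q"
          by (intro measure_Un_le sig_ev q_ev)
        finally have "prob (?P \<union> ?Q \<union> ?R) < e" using elim C(2)[of n] by linarith
        moreover have "prob (good \<delta> C \<tau> n) = 1 - prob (?P \<union> ?Q \<union> ?R)"
          unfolding good_eq by (intro prob_compl sets.Un sig_ev q_ev dev_sets)
        ultimately show ?case by linarith
      qed
    qed
    with C(1) show ?thesis by blast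
  qed
  have h_pos: "\<forall>\<^sub>F n in sequentially. h n > 0"
    using eventually_compose_filterlim[OF eventually_gt_at_top h_inf] .

  \<comment> \<open>No probability is left here: on the good event the centre beats all distant
    points, with \<open>K\<close> the same for all large \<open>n\<close> and all \<omega>.\<close>
  have key: "\<exists>\<delta>>0. \<exists>\<tau>>0. \<exists>K\<ge>0. \<forall>\<^sub>F n in sequentially. \<forall>\<omega>\<in>good \<delta> C \<tau> n. \<forall>m. K < \<bar>m - \<mu>\<^sub>0\<bar> \<longrightarrow>
      criterion \<rho> n (\<lambda>i. y n i \<omega>) (\<sigma>hat n \<omega>) \<mu>\<^sub>0 < criterion \<rho> n (\<lambda>i. y n i \<omega>) (\<sigma>hat n \<omega>) m"
    if C: "C > 0" for C
    using cases
  proof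

    \<comment> \<open>Linearly growing tails\<close>
    assume psi: "\<psi>\<^sub>s > 0 \<and> lam > 1 / 2"
    \<comment> \<open>With this \<delta> the scale estimate stays positive and below twice its
      limit, which is the factor in \<open>D\<close>. The choice of \<eta> makes
      \<open>(1 + \<eta>) / 2\<close> the midpoint of 1/2 and \<open>lam\<close>, so the good
      fraction eventually exceeds it. \<open>K\<close> solves
      \<open>2 * A + D = \<eta> * K\<close>.\<close>
    define \<delta> where "\<delta> = vsig * \<sigma>\<^sub>0 / 2"
    define \<eta> where "\<eta> = lam - 1 / 2"
    define A where "A = \<sigma>\<^sub>0 * (1 + C)"
    define D where "D = (\<psi>\<^sub>s * x\<^sub>s + \<rho>\<^sub>s) * (2 * (vsig * \<sigma>\<^sub>0)) / \<psi>\<^sub>s"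
    define K where "K = (2 * A + D) / \<eta>"
    have vs: "vsig * \<sigma>\<^sub>0 > 0" using varsigma sigma0 by simp
    have eta: "\<eta> > 0" using psi by (simp add: \<eta>_def)
    have AD: "A > 0" "D > 0" using psi vs sigma0 C rho_pos by (auto simp: A_def D_def add_pos_pos)
    have "\<forall>\<^sub>F n in sequentially. real (h n) / real n > (1 + \<eta>) / 2"
      using psi by (intro order_tendstoD(1)[OF h_ratio]) (simp add: \<eta>_def field_simps)
    with h_pos have "\<forall>\<^sub>F n in sequentially. \<forall>\<omega>\<in>good \<delta> C 1 n. \<forall>m. K < \<bar>m - \<mu>\<^sub>0\<bar> \<longrightarrow>
      criterion \<rho> n (\<lambda>i. y n i \<omega>) (\<sigma>hat n \<omega>) \<mu>\<^sub>0 < criterion \<rho> n (\<lambda>i. y n i \<omega>) (\<sigma>hat n \<omega>) m"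
    proof eventually_elim
      case (elim n)
      have n: "n > 0" using elim(1) h_le[of n] by linarith
      show ?case
      proof (intro ballI allI impI)
        fix \<omega> m assume w: "\<omega> \<in> good \<delta> C 1 n" and m: "K < \<bar>m - \<mu>\<^sub>0\<bar>"
        have "\<bar>\<sigma>hat n \<omega> - vsig * \<sigma>\<^sub>0\<bar> \<le> vsig * \<sigma>\<^sub>0 / 2" using w by (simp add: good_def \<delta>_def)
        then have s: "\<sigma>hat n \<omega> > 0" "\<sigma>hat n \<omega> \<le> 2 * (vsig * \<sigma>\<^sub>0)" using vs by linarith+
        show "criterion \<rho> n (\<lambda>i. y n i \<omega>) (\<sigma>hat n \<omega>) \<mu>\<^sub>0 < criterion \<rho> n (\<lambda>i. y n i \<omega>) (\<sigma>hat n \<omega>) m"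
        proof (rule criterion_less_far_linear_tails[OF rho _ s(1) n zeta(1), where \<eta> = \<eta> and A = A])
          show "\<psi>\<^sub>s > 0" using psi by simp
          show "real n + \<eta> * real n \<le> 2 * real (card (\<zeta> n))"
            using elim(2) n by (simp add: zeta(2) field_simps)
          \<comment> \<open>This bounds the absolute deviations by the second moment
            \<open>q\<close>, and it is the source of \<open>1 + C\<close> in
            \<open>A\<close>.\<close>
          have abs_le: "\<bar>x\<bar> \<le> 1 + x\<^sup>2" for x :: real
            using zero_le_power2[of "\<bar>x\<bar> - 1"] by (simp add: power2_eq_square algebra_simps)
          have "(\<Sum>i\<in>\<zeta> n. \<bar>y n i \<omega> - \<mu>\<^sub>0\<bar>) = \<sigma>\<^sub>0 * (\<Sum>i\<in>\<zeta> n. \<bar>\<epsilon> n i \<omega>\<bar>)"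
            using sigma0 by (simp add: obs abs_mult sum_distrib_left)
          also have "\<dots> \<le> \<sigma>\<^sub>0 * (\<Sum>i\<in>\<zeta> n. 1 + (\<epsilon> n i \<omega>)\<^sup>2)"
            using sigma0 abs_le by (intro mult_left_mono sum_mono) auto
          also have "\<dots> = \<sigma>\<^sub>0 * (real (h n) * (1 + q n \<omega>))"
            using elim(1) by (simp add: sum.distrib zeta(2) q_def algebra_simps)
          also have "\<dots> \<le> \<sigma>\<^sub>0 * (real n * (1 + C))"
            using w sigma0 h_le[of n] C
            by (intro mult_left_mono mult_mono) (auto simp: good_def q_def intro!: add_nonneg_nonneg divide_nonneg_nonneg sum_nonneg)
          finally show "(\<Sum>i\<in>\<zeta> n. \<bar>y n i \<omega> - \<mu>\<^sub>0\<bar>) \<le> A * real n"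
            by (simp add: A_def algebra_simps)
          have "(\<psi>\<^sub>s * x\<^sub>s + \<rho>\<^sub>s) * \<sigma>hat n \<omega> / \<psi>\<^sub>s \<le> D"
            unfolding D_def using psi rho_pos s by (intro divide_right_mono mult_left_mono) auto
          moreover have "2 * A + D < \<eta> * \<bar>m - \<mu>\<^sub>0\<bar>"
            using m eta by (simp add: K_def pos_divide_less_eq mult.commute)
          ultimately show "2 * A + (\<psi>\<^sub>s * x\<^sub>s + \<rho>\<^sub>s) * \<sigma>hat n \<omega> / \<psi>\<^sub>s < \<eta> * \<bar>m - \<mu>\<^sub>0\<bar>"
            by linarith
        qed
      qed
    qed
    moreover have "\<delta> > 0" "K \<ge> 0" using vs eta AD by (auto simp: \<delta>_def K_def)
    ultimately show ?thesis using zero_less_one by blast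
  next

    \<comment> \<open>Constant tails\<close>
    assume psi: "\<psi>\<^sub>s = 0 \<and> lam > 1 / (2 - \<rho>tilde vsig / \<rho>\<^sub>s)"
    have rho0: "rho_condition \<rho> x\<^sub>s \<rho>\<^sub>s 0" using rho psi by simp
    define r where "r = \<rho>tilde vsig"
    \<comment> \<open>The averages are at most \<open>\<rho>\<^sub>s\<close>, and on an event of
      positive probability, hence nonempty, they are within \<tau> of \<open>r\<close>. The bound
      makes \<open>2 - r / \<rho>\<^sub>s\<close> positive, so that the condition on
      \<open>lam\<close> can be multiplied out.\<close>
    have r_le: "r \<le> \<rho>\<^sub>s"
    proof (rule field_le_epsilon)
      fix \<tau> :: real assume \<tau>: "\<tau> > 0"
      obtain C where "\<forall>\<^sub>F n in sequentially. measure (M n) (good 1 C \<tau> n) > 1 - 1"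
        using good_large[OF zero_less_one] \<tau> zero_less_one by meson
      with h_pos have "\<forall>\<^sub>F n in sequentially. h n > 0 \<and> measure (M n) (good 1 C \<tau> n) > 0"
        by eventually_elim simp
      then obtain n where n: "h n > 0" "measure (M n) (good 1 C \<tau> n) > 0"
        using eventually_happens sequentially_bot by blast
      then obtain \<omega> where "\<omega> \<in> good 1 C \<tau> n"
        by (metis all_not_in_conv less_irrefl measure_empty)
      then have "\<bar>X n vsig \<omega> - r\<bar> \<le> \<tau>" using U(2) by (auto simp: good_def r_def)
      moreover have "X n vsig \<omega> \<le> \<rho>\<^sub>s"
      proof -
        have "(\<Sum>i\<in>\<zeta> n. \<rho> (\<epsilon> n i \<omega> / vsig)) \<le> (\<Sum>i\<in>\<zeta> n. \<rho>\<^sub>s)"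
          using rho_condition_upper[OF rho0] by (intro sum_mono) simp
        then show ?thesis using n(1) by (simp add: X_def zeta(2) pos_divide_le_eq mult.commute)
      qed
      ultimately show "r \<le> \<rho>\<^sub>s + \<tau>" by linarith
    qed
    \<comment> \<open>\<kappa> is the limit of
      \<open>(h * \<rho>\<^sub>s - h * r - (n - h) * \<rho>\<^sub>s) / n\<close>, the asymptotic gap
      per observation between a distant point and the centre.\<close>
    define \<kappa> where "\<kappa> = lam * (2 * \<rho>\<^sub>s - r) - \<rho>\<^sub>s"
    have kap: "\<kappa> > 0"
    proof -
      have "r / \<rho>\<^sub>s \<le> 1" using r_le rho_pos by simp
      then have "1 < lam * (2 - r / \<rho>\<^sub>s)"
        using psi by (simp add: r_def pos_divide_less_eq)
      then have "\<rho>\<^sub>s * 1 < \<rho>\<^sub>s * (lam * (2 - r / \<rho>\<^sub>s))"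
        using rho_pos by (intro mult_strict_left_mono)
      then show ?thesis using rho_pos by (simp add: \<kappa>_def algebra_simps)
    qed
    \<comment> \<open>Half of \<kappa> is reserved for the convergence of \<open>h / n\<close>. Of
      the rest, \<open>2 * \<tau> = \<kappa> / 4\<close> pays for the average of \<rho> at the
      centre, and \<open>\<kappa> / 4\<close> for the good errors larger than
      \<open>L\<close>.\<close>
    define \<tau> where "\<tau> = \<kappa> / 8"
    have tau: "\<tau> > 0" using kap by (simp add: \<tau>_def)
    obtain d where d: "d > 0" "\<And>\<alpha>. \<bar>\<alpha> - vsig\<bar> < d \<Longrightarrow> \<alpha> \<in> U \<and> \<bar>\<rho>tilde \<alpha> - r\<bar> < \<tau>"
    proof -
      obtain d1 where d1: "d1 > 0" "ball vsig d1 \<subseteq> U"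
        using U(1,2) open_contains_ball by blast
      obtain d2 where "d2 > 0" "\<And>\<alpha>. \<alpha> \<in> U \<Longrightarrow> dist \<alpha> vsig < d2 \<Longrightarrow> dist (\<rho>tilde \<alpha>) r < \<tau>"
        using A3_cont U(2) tau unfolding continuous_on_iff r_def by blast
      with d1 show ?thesis
        by (intro that[of "min d1 d2"]) (auto simp: dist_real_def subset_iff abs_minus_commute)
    qed
    \<comment> \<open>The first term keeps the scale estimate positive and bounded; the second
      brings its ratio to \<open>\<sigma>\<^sub>0\<close> within \<open>d\<close> of
      \<open>vsig\<close>. \<open>L\<close> is chosen so that the Chebyshev bound costs exactly
      \<open>\<kappa> / 4\<close>.\<close>
    define \<delta> where "\<delta> = min (vsig * \<sigma>\<^sub>0 / 2) (\<sigma>\<^sub>0 * d / 2)"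
    define L where "L = sqrt (4 * \<rho>\<^sub>s * C / \<kappa>)"
    have L: "L > 0" "\<rho>\<^sub>s * (C / L\<^sup>2) = \<kappa> / 4"
      using rho_pos C kap by (auto simp: L_def)
    define K where "K = \<sigma>\<^sub>0 * L + x\<^sub>s * (2 * (vsig * \<sigma>\<^sub>0))"
    have vs: "vsig * \<sigma>\<^sub>0 > 0" using varsigma sigma0 by simp
    have "(\<lambda>n. real (h n) / real n * (2 * \<rho>\<^sub>s - r)) \<longlonglongrightarrow> lam * (2 * \<rho>\<^sub>s - r)"
      by (intro tendsto_intros h_ratio)
    then have "\<forall>\<^sub>F n in sequentially. real (h n) / real n * (2 * \<rho>\<^sub>s - r) > \<rho>\<^sub>s + \<kappa> / 2"
      using kap by (rule_tac order_tendstoD(1)) (auto simp: \<kappa>_def field_simps)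
    with h_pos have "\<forall>\<^sub>F n in sequentially. \<forall>\<omega>\<in>good \<delta> C \<tau> n. \<forall>m. K < \<bar>m - \<mu>\<^sub>0\<bar> \<longrightarrow>
      criterion \<rho> n (\<lambda>i. y n i \<omega>) (\<sigma>hat n \<omega>) \<mu>\<^sub>0 < criterion \<rho> n (\<lambda>i. y n i \<omega>) (\<sigma>hat n \<omega>) m"
    proof eventually_elim
      case (elim n)
      have n: "n > 0" using elim(1) h_le[of n] by linarith
      show ?case
      proof (intro ballI allI impI)
        fix \<omega> m assume w: "\<omega> \<in> good \<delta> C \<tau> n" and m: "K < \<bar>m - \<mu>\<^sub>0\<bar>"
        define s where "s = \<sigma>hat n \<omega>"
        have dev: "\<bar>s - vsig * \<sigma>\<^sub>0\<bar> \<le> \<delta>" using w by (simp add: good_def s_def)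
        then have "\<bar>s - vsig * \<sigma>\<^sub>0\<bar> \<le> vsig * \<sigma>\<^sub>0 / 2" by (simp add: \<delta>_def)
        then have s: "s > 0" "s \<le> 2 * (vsig * \<sigma>\<^sub>0)" using vs by linarith+
        have "\<bar>s / \<sigma>\<^sub>0 - vsig\<bar> = \<bar>s - vsig * \<sigma>\<^sub>0\<bar> / \<sigma>\<^sub>0"
        proof -
          have "s / \<sigma>\<^sub>0 - vsig = (s - vsig * \<sigma>\<^sub>0) / \<sigma>\<^sub>0" using sigma0 by (simp add: diff_divide_distrib)
          then show ?thesis using sigma0 by (simp add: abs_divide)
        qed
        also have "\<dots> < d"
        proof -
          have "\<bar>s - vsig * \<sigma>\<^sub>0\<bar> \<le> \<sigma>\<^sub>0 * d / 2" using dev by (simp add: \<delta>_def)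
          moreover have "0 < \<sigma>\<^sub>0 * d" using sigma0 d(1) by simp
          ultimately have "\<bar>s - vsig * \<sigma>\<^sub>0\<bar> < \<sigma>\<^sub>0 * d" by linarith
          then show ?thesis using sigma0 by (simp add: pos_divide_less_eq mult.commute)
        qed
        finally have \<alpha>: "s / \<sigma>\<^sub>0 \<in> U" "\<bar>\<rho>tilde (s / \<sigma>\<^sub>0) - r\<bar> < \<tau>" using d(2) by blast+
        have "\<bar>X n (s / \<sigma>\<^sub>0) \<omega> - \<rho>tilde (s / \<sigma>\<^sub>0)\<bar> \<le> \<tau>" using w \<alpha>(1) by (auto simp: good_def)
        then have X: "X n (s / \<sigma>\<^sub>0) \<omega> \<le> r + 2 * \<tau>" using \<alpha>(2) by linarith
        \<comment> \<open>At the centre the residuals are errors scaled by the random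
          \<open>s / \<sigma>\<^sub>0\<close>; this is why convergence uniform in \<alpha> is
          required.\<close>
        have std: "(y n i \<omega> - \<mu>\<^sub>0) / s = \<epsilon> n i \<omega> / (s / \<sigma>\<^sub>0)" for i by (simp add: obs mult.commute)
        have "criterion \<rho> n (\<lambda>i. y n i \<omega>) s \<mu>\<^sub>0 < criterion \<rho> n (\<lambda>i. y n i \<omega>) s m"
        proof (rule criterion_less_far_constant_tails[OF rho0 s(1) zeta(1),
              where q = "real (h n) * (r + 2 * \<tau>)" and L = "\<sigma>\<^sub>0 * L"])
          show "(\<Sum>i\<in>\<zeta> n. \<rho> ((y n i \<omega> - \<mu>\<^sub>0) / s)) \<le> real (h n) * (r + 2 * \<tau>)"
            unfolding std using X elim(1) by (simp add: X_def pos_divide_le_eq mult.commute)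
          have "x\<^sub>s * s \<le> x\<^sub>s * (2 * (vsig * \<sigma>\<^sub>0))" using s rho_pos by (intro mult_left_mono) auto
          then show "\<sigma>\<^sub>0 * L + x\<^sub>s * s \<le> \<bar>m - \<mu>\<^sub>0\<bar>" using m by (simp add: K_def)
          have "{i \<in> \<zeta> n. \<bar>y n i \<omega> - \<mu>\<^sub>0\<bar> \<le> \<sigma>\<^sub>0 * L} = \<zeta> n - {i \<in> \<zeta> n. L < \<bar>\<epsilon> n i \<omega>\<bar>}"
            using sigma0 by (auto simp: obs abs_mult)
          moreover have "card (\<zeta> n - {i \<in> \<zeta> n. L < \<bar>\<epsilon> n i \<omega>\<bar>}) = h n - card {i \<in> \<zeta> n. L < \<bar>\<epsilon> n i \<omega>\<bar>}"
            using zeta_fin[of n] by (subst card_Diff_subset) (auto simp: zeta(2))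
          \<comment> \<open>This lets the difference of natural numbers above become a difference of
            reals.\<close>
          moreover have "card {i \<in> \<zeta> n. L < \<bar>\<epsilon> n i \<omega>\<bar>} \<le> h n"
            unfolding zeta(2)[symmetric] by (intro card_mono zeta_fin) auto
          ultimately have card_eq: "real (card {i \<in> \<zeta> n. \<bar>y n i \<omega> - \<mu>\<^sub>0\<bar> \<le> \<sigma>\<^sub>0 * L})
              = real (h n) - real (card {i \<in> \<zeta> n. L < \<bar>\<epsilon> n i \<omega>\<bar>})"
            by (simp only: of_nat_diff)
          have "real (card {i \<in> \<zeta> n. L < \<bar>\<epsilon> n i \<omega>\<bar>}) \<le> (\<Sum>i\<in>\<zeta> n. (\<epsilon> n i \<omega>)\<^sup>2) / L\<^sup>2"
            by (intro card_large_le_second_moment zeta_fin L(1))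
          also have "\<dots> = real (h n) * q n \<omega> / L\<^sup>2"
            using elim(1) by (simp add: q_def)
          also have "\<dots> \<le> real (h n) * (C / L\<^sup>2)"
            using w by (auto simp: good_def intro!: divide_right_mono mult_left_mono)
          finally have "\<rho>\<^sub>s * real (card {i \<in> \<zeta> n. L < \<bar>\<epsilon> n i \<omega>\<bar>}) \<le> \<rho>\<^sub>s * (real (h n) * (C / L\<^sup>2))"
            using rho_pos by (intro mult_left_mono) auto
          also have "\<dots> = real (h n) * (\<kappa> / 4)"
            by (simp only: mult.left_commute[of \<rho>\<^sub>s] L(2))
          finally have few: "\<rho>\<^sub>s * real (card {i \<in> \<zeta> n. L < \<bar>\<epsilon> n i \<omega>\<bar>}) \<le> real (h n) * (\<kappa> / 4)" .
          \<comment> \<open>The gap exceeds \<open>n * \<kappa> / 2\<close>, while the two errors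
            together cost at most \<open>h * \<kappa> / 2\<close>.\<close>
          have "real (h n) * (2 * \<rho>\<^sub>s - r) > real n * (\<rho>\<^sub>s + \<kappa> / 2)"
            using elim(2) n by (simp add: pos_less_divide_eq mult.commute)
          moreover have "real (h n) * (\<kappa> / 2) \<le> real n * (\<kappa> / 2)"
            using h_le[of n] kap by (intro mult_right_mono) auto
          ultimately show "real (h n) * (r + 2 * \<tau>) + \<rho>\<^sub>s * (real n - real (card (\<zeta> n)))
              < \<rho>\<^sub>s * real (card {i \<in> \<zeta> n. \<bar>y n i \<omega> - \<mu>\<^sub>0\<bar> \<le> \<sigma>\<^sub>0 * L})"
            using few unfolding card_eq zeta(2) \<tau>_def by (simp add: algebra_simps)
        qed
        then show "criterion \<rho> n (\<lambda>i. y n i \<omega>) (\<sigma>hat n \<omega>) \<mu>\<^sub>0 < criterion \<rho> n (\<lambda>i. y n i \<omega>) (\<sigma>hat n \<omega>) m"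
          by (simp add: s_def)
      qed
    qed
    moreover have "\<delta> > 0" "K \<ge> 0" using vs sigma0 d(1) L(1) rho_pos by (auto simp: \<delta>_def K_def)
    ultimately show ?thesis using tau by blast
  qed

  \<comment> \<open>Bounded minimizers and a measurable selection on the good event\<close>
  show ?thesis
  proof (intro allI impI)
    fix e :: real assume "e > 0"
    from good_large[OF this] obtain C where C: "C > 0"
      "\<And>\<delta> \<tau>. \<delta> > 0 \<Longrightarrow> \<tau> > 0 \<Longrightarrow> \<forall>\<^sub>F n in sequentially. measure (M n) (good \<delta> C \<tau> n) > 1 - e"
      by meson
    obtain \<delta> \<tau> K where K: "\<delta> > 0" "\<tau> > 0" "K \<ge> 0"
      "\<forall>\<^sub>F n in sequentially. \<forall>\<omega>\<in>good \<delta> C \<tau> n. \<forall>m. K < \<bar>m - \<mu>\<^sub>0\<bar> \<longrightarrow>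
      criterion \<rho> n (\<lambda>i. y n i \<omega>) (\<sigma>hat n \<omega>) \<mu>\<^sub>0 < criterion \<rho> n (\<lambda>i. y n i \<omega>) (\<sigma>hat n \<omega>) m"
      using key[OF C(1)] by (elim exE conjE)
    obtain n\<^sub>0 where n0: "\<And>n. n \<ge> n\<^sub>0 \<Longrightarrow> measure (M n) (good \<delta> C \<tau> n) > 1 - e \<and>
      (\<forall>\<omega>\<in>good \<delta> C \<tau> n. \<forall>m. K < \<bar>m - \<mu>\<^sub>0\<bar> \<longrightarrow>
      criterion \<rho> n (\<lambda>i. y n i \<omega>) (\<sigma>hat n \<omega>) \<mu>\<^sub>0 < criterion \<rho> n (\<lambda>i. y n i \<omega>) (\<sigma>hat n \<omega>) m)"
      using eventually_conj[OF C(2)[OF K(1,2)] K(4)] unfolding eventually_sequentially by blast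
    show "\<exists>B n\<^sub>0. \<forall>n\<ge>n\<^sub>0. \<exists>S \<in> sets (M n). measure (M n) S > 1 - e \<and>
           (\<forall>\<omega>\<in>S. \<forall>m. is_arg_min (criterion \<rho> n (\<lambda>i. y n i \<omega>) (\<sigma>hat n \<omega>)) (\<lambda>_. True) m \<longrightarrow> \<bar>m\<bar> \<le> B) \<and>
           (\<exists>\<mu>hat \<in> borel_measurable (M n). \<forall>\<omega>\<in>S.
              is_arg_min (criterion \<rho> n (\<lambda>i. y n i \<omega>) (\<sigma>hat n \<omega>)) (\<lambda>_. True) (\<mu>hat \<omega>))"
    proof (intro exI[of _ "\<bar>\<mu>\<^sub>0\<bar> + K"] exI[of _ n\<^sub>0] allI impI)
      fix n assume n: "n \<ge> n\<^sub>0"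
      show "\<exists>S \<in> sets (M n). measure (M n) S > 1 - e \<and>
           (\<forall>\<omega>\<in>S. \<forall>m. is_arg_min (criterion \<rho> n (\<lambda>i. y n i \<omega>) (\<sigma>hat n \<omega>)) (\<lambda>_. True) m \<longrightarrow> \<bar>m\<bar> \<le> \<bar>\<mu>\<^sub>0\<bar> + K) \<and>
           (\<exists>\<mu>hat \<in> borel_measurable (M n). \<forall>\<omega>\<in>S.
              is_arg_min (criterion \<rho> n (\<lambda>i. y n i \<omega>) (\<sigma>hat n \<omega>)) (\<lambda>_. True) (\<mu>hat \<omega>))"
      proof (rule bexI[OF conjI good_sets])
        show "measure (M n) (good \<delta> C \<tau> n) > 1 - e" using n0[OF n] by blast
        show "(\<forall>\<omega>\<in>good \<delta> C \<tau> n. \<forall>m. is_arg_min (criterion \<rho> n (\<lambda>i. y n i \<omega>) (\<sigma>hat n \<omega>)) (\<lambda>_. True) m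
              \<longrightarrow> \<bar>m\<bar> \<le> \<bar>\<mu>\<^sub>0\<bar> + K) \<and>
           (\<exists>\<mu>hat \<in> borel_measurable (M n). \<forall>\<omega>\<in>good \<delta> C \<tau> n.
              is_arg_min (criterion \<rho> n (\<lambda>i. y n i \<omega>) (\<sigma>hat n \<omega>)) (\<lambda>_. True) (\<mu>hat \<omega>))"
          using n0[OF n]
          by (intro argmin_bounded_and_measurable[OF crit_meas crit_cont good_sets K(3)]) blast
      qed
    qed
  qed
qed

end
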